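(* Let $\Omega\subseteq\mathbb{C}^n$ be a domain, let $\mathcal{H},\tilde{\mathcal{H}}\in B_1^*(\Omega)$ be such that $\mathcal{M}(\mathcal{H})\subseteq\mathcal{M}(\tilde{\mathcal{H}})$, and let $\Theta\in\mathcal{M}(\mathcal{H})\otimes\mathcal{B}(\mathbb{C}^p,\mathbb{C}^q)$, where $1\le p<q$, be left invertible (i.e. have a left inverse in $\mathcal{M}(\mathcal{H})\otimes\mathcal{B}(\mathbb{C}^q,\mathbb{C}^p)$). Then the similarity of $\mathcal{H}_\Theta=(\mathcal{H}\otimes\mathbb{C}^q)/M_\Theta(\mathcal{H}\otimes\mathbb{C}^p)$ to $\mathcal{H}\otimes\mathbb{C}^{q-p}$ implies the similarity of $\tilde{\mathcal{H}}_\Theta=(\tilde{\mathcal{H}}\otimes\mathbb{C}^q)/M_\Theta(\tilde{\mathcal{H}}\otimes\mathbb{C}^p)$ to $\tilde{\mathcal{H}}\otimes\mathbb{C}^{q-p}$.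
   Context: A Hilbert module over $\mathbb{C}[z_1,\dots,z_n]$ is a Hilbert space $\mathcal{H}$ with commuting bounded operators $M_{z_1},\dots,M_{z_n}$ on it, acting by $p\cdot h=p(M_{z_1},\dots,M_{z_n})h$. A module map is a bounded linear map intertwining the operators $M_{z_i}$; two Hilbert modules are similar if there is an invertible module map between them. A domain is a connected open set. $B_1^*(\Omega)$ is the set of Hilbert modules $\mathcal{H}$ over $\mathbb{C}[z_1,\dots,z_n]$ such that: (i) for every $w\in\Omega$ the column operator $(M_z-wI_{\mathcal{H}})^*:\mathcal{H}\to\mathcal{H}^n$, $h\mapsto (M_{z_1}-w_1I)^*h\oplus\cdots\oplus(M_{z_n}-w_nI)^*h$, has closed range; (ii) $\dim\ker(M_z-wI_{\mathcal{H}})^*=1$ for every $w\in\Omega$; (iii) the closed linear span of $\bigcup_{w\in\Omega}\ker(M_z-wI_{\mathcal{H}})^*$ is $\mathcal{H}$. Write $E^*_{\mathcal{H}}(w)=\ker(M_z-wI_{\mathcal{H}})^*$. $\mathcal{M}(\mathcal{H})$ is the multiplier algebra: functions $\varphi:\Omega\to\mathbb{C}$ for which pointwise multiplication defines a bounded operator $M_\varphi$ on $\mathcal{H}$ (elements of $\mathcal{H}$ being regarded, locally, as functions on $\Omega$ via evaluation against $E_{\mathcal{H}}^*(w)$); equivalently there is a bounded $M_\varphi$ on $\mathcal{H}$ with $M_\varphi^*k=\overline{\varphi(w)}k$ for all $w\in\Omega$, $k\in E^*_{\mathcal{H}}(w)$. An element $\Theta=[\theta_{i,j}]$ of $\mathcal{M}(\mathcal{H})\otimes\mathcal{B}(\mathbb{C}^p,\mathbb{C}^q)$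 is a $q\times p$ matrix of multipliers, and $M_\Theta:\mathcal{H}\otimes\mathbb{C}^p\to\mathcal{H}\otimes\mathbb{C}^q$ is the corresponding matrix of operators $[M_{\theta_{i,j}}]$; since $\mathcal{M}(\mathcal{H})\subseteq\mathcal{M}(\tilde{\mathcal{H}})$, the same $\Theta$ also defines $M_\Theta:\tilde{\mathcal{H}}\otimes\mathbb{C}^p\to\tilde{\mathcal{H}}\otimes\mathbb{C}^q$. $\Psi$ is a left inverse of $\Theta$ if $\Psi(w)\Theta(w)=I$ for all $w\in\Omega$. Quotients carry the quotient norm and induced module action. *)

theory Defs
  imports "HOL-Analysis.Analysis" "HOL-Library.Set_Algebras"
begin

section \<open>Complex Hilbert spaces\<close>

text \<open>The inner product is linear in its first argument; its real part is the real inner product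
  that the library uses for the norm and the topology.\<close>

class complex_inner = real_inner +
  fixes scaleC :: "complex \<Rightarrow> 'a \<Rightarrow> 'a"  (infixr \<open>*\<^sub>C\<close> 75)
    and cinner :: "'a \<Rightarrow> 'a \<Rightarrow> complex"
  assumes scaleC_add_right: "c *\<^sub>C (x + y) = c *\<^sub>C x + c *\<^sub>C y"
    and scaleC_add_left: "(c + d) *\<^sub>C x = c *\<^sub>C x + d *\<^sub>C x"
    and scaleC_scaleC: "c *\<^sub>C d *\<^sub>C x = (c * d) *\<^sub>C x"
    and scaleR_scaleC: "r *\<^sub>R x = complex_of_real r *\<^sub>C x"
    and cinner_commute: "cinner x y = cnj (cinner y x)"
    and cinner_add_left: "cinner (x + y) z = cinner x z + cinner y z"
    and cinner_scaleC_left: "cinner (c *\<^sub>C x) y = c * cinner x y"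
    and inner_eq_Re_cinner: "x \<bullet> y = Re (cinner x y)"

class complex_hilbert = complex_inner + complete_space

global_interpretation complex_space: vector_space "scaleC :: complex \<Rightarrow> 'a \<Rightarrow> 'a::complex_inner"
proof
  fix x :: 'a
  show "1 *\<^sub>C x = x"
    using scaleR_scaleC[of 1 x] by simp
qed (simp_all add: scaleC_add_right scaleC_add_left scaleC_scaleC)

instantiation complex :: complex_hilbert
begin
definition scaleC_complex :: "complex \<Rightarrow> complex \<Rightarrow> complex" where
  "scaleC_complex c x = c * x"
definition cinner_complex :: "complex \<Rightarrow> complex \<Rightarrow> complex" where
  "cinner_complex x y = x * cnj y"
instance
  by standard
    (simp_all add: scaleC_complex_def cinner_complex_def algebra_simps scaleR_conv_of_real
      inner_complex_def)
end

text \<open>The type \<^typ>\<open>'a ^ 'm\<close> is the Hilbert space tensor product of \<^typ>\<open>'a\<close> with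
  complex \<open>m\<close>-space, \<open>m = CARD('m)\<close>.\<close>

instantiation vec :: (complex_inner, finite) complex_inner
begin
definition scaleC_vec :: "complex \<Rightarrow> 'a ^ 'b \<Rightarrow> 'a ^ 'b" where
  "scaleC_vec c x = (\<chi> i. c *\<^sub>C (x $ i))"
definition cinner_vec :: "'a ^ 'b \<Rightarrow> 'a ^ 'b \<Rightarrow> complex" where
  "cinner_vec x y = (\<Sum>i\<in>UNIV. cinner (x $ i) (y $ i))"
instance
proof
  fix x y :: "'a ^ 'b"
  show "cinner x y = cnj (cinner y x)"
    unfolding cinner_vec_def cnj_sum using cinner_commute by (intro sum.cong) auto
qed (simp_all add: scaleC_vec_def cinner_vec_def vec_eq_iff scaleC_add_right scaleC_add_left
      scaleC_scaleC scaleR_scaleC cinner_add_left cinner_scaleC_left inner_vec_def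
      inner_eq_Re_cinner sum.distrib sum_distrib_left)
end

instance vec :: (complex_hilbert, finite) complex_hilbert ..

definition bounded_clinear :: "('a::complex_inner \<Rightarrow> 'b::complex_inner) \<Rightarrow> bool" where
  "bounded_clinear T \<longleftrightarrow> bounded_linear T \<and> (\<forall>c x. T (c *\<^sub>C x) = c *\<^sub>C T x)"

text \<open>Only meaningful for bounded operators between Hilbert spaces, for which the adjoint exists
  and is unique.\<close>

definition cadjoint :: "('a::complex_inner \<Rightarrow> 'b::complex_inner) \<Rightarrow> 'b \<Rightarrow> 'a" where
  "cadjoint T = (SOME S. \<forall>x y. cinner (T x) y = cinner x (S y))"


section \<open>Modules, quotients and similarity\<close>

text \<open>A Hilbert module over the polynomial ring in the variables \<open>z\<^sub>i\<close>, \<open>i :: 'n\<close>, is given by a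
  type \<^typ>\<open>'h\<close> of class \<^class>\<open>complex_hilbert\<close> together with the family of operators by which
  the \<open>z\<^sub>i\<close> act.\<close>

definition hilbert_module :: "('n \<Rightarrow> 'h::complex_hilbert \<Rightarrow> 'h) \<Rightarrow> bool" where
  "hilbert_module M \<longleftrightarrow> (\<forall>i. bounded_clinear (M i)) \<and> (\<forall>i j. M i \<circ> M j = M j \<circ> M i)"

text \<open>Quotients depend on terms and so are not types; the following record, with an explicit
  carrier, covers both them and Hilbert modules living on a whole type. It is pure data: no axioms are imposed.\<close>

record ('n, 'a) normed_module =
  mcarrier :: "'a set"
  madd :: "'a \<Rightarrow> 'a \<Rightarrow> 'a"
  mscale :: "complex \<Rightarrow> 'a \<Rightarrow> 'a"
  mnorm :: "'a \<Rightarrow> real"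
  mact :: "'n \<Rightarrow> 'a \<Rightarrow> 'a"

definition full_module :: "('n \<Rightarrow> 'h::complex_hilbert \<Rightarrow> 'h) \<Rightarrow> ('n, 'h) normed_module" where
  "full_module M =
     \<lparr>mcarrier = UNIV, madd = (+), mscale = scaleC, mnorm = norm, mact = M\<rparr>"

text \<open>The elements are the cosets \<open>x + N\<close>. The image of a coset under a scalar or under \<open>M i\<close>
  need not be a full coset (e.g. for the scalar 0), hence the added \<open>N\<close>.\<close>

definition quotient_module ::
    "('n \<Rightarrow> 'h::complex_hilbert \<Rightarrow> 'h) \<Rightarrow> 'h set \<Rightarrow> ('n, 'h set) normed_module" where
  "quotient_module M N =
     \<lparr>mcarrier = range (\<lambda>x. x +o N),
      madd = (\<lambda>A B. A + B),
      mscale = (\<lambda>c A. scaleC c ` A + N),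
      mnorm = (\<lambda>A. Inf (norm ` A)),
      mact = (\<lambda>i A. M i ` A + N)\<rparr>"

definition module_map ::
    "('n, 'a) normed_module \<Rightarrow> ('n, 'b) normed_module \<Rightarrow> ('a \<Rightarrow> 'b) \<Rightarrow> bool" where
  "module_map A B T \<longleftrightarrow>
     T ` mcarrier A \<subseteq> mcarrier B \<and>
     (\<forall>x\<in>mcarrier A. \<forall>y\<in>mcarrier A. T (madd A x y) = madd B (T x) (T y)) \<and>
     (\<forall>c. \<forall>x\<in>mcarrier A. T (mscale A c x) = mscale B c (T x)) \<and>
     (\<exists>K. \<forall>x\<in>mcarrier A. mnorm B (T x) \<le> K * mnorm A x) \<and>
     (\<forall>i. \<forall>x\<in>mcarrier A. T (mact A i x) = mact B i (T x))"

definition similar_modules ::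
    "('n, 'a) normed_module \<Rightarrow> ('n, 'b) normed_module \<Rightarrow> bool" where
  "similar_modules A B \<longleftrightarrow>
     (\<exists>T S. module_map A B T \<and> module_map B A S \<and>
        (\<forall>x\<in>mcarrier A. S (T x) = x) \<and> (\<forall>y\<in>mcarrier B. T (S y) = y))"

text \<open>The action on the tensor product with complex \<open>m\<close>-space.\<close>

definition tensor_action :: "('n \<Rightarrow> 'h \<Rightarrow> 'h) \<Rightarrow> 'n \<Rightarrow> 'h ^ 'm \<Rightarrow> 'h ^ 'm" where
  "tensor_action M i x = (\<chi> j. M i (x $ j))"


section \<open>The class \<open>B\<^sub>1\<^sup>*\<close> and multipliers\<close>

definition column_adjoint ::
    "('n \<Rightarrow> 'h::complex_hilbert \<Rightarrow> 'h) \<Rightarrow> complex ^ 'n \<Rightarrow> 'h \<Rightarrow> 'h ^ 'n" where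
  "column_adjoint M w h = (\<chi> i. cadjoint (\<lambda>x. M i x - (w $ i) *\<^sub>C x) h)"

definition E_star :: "('n::finite \<Rightarrow> 'h::complex_hilbert \<Rightarrow> 'h) \<Rightarrow> complex ^ 'n \<Rightarrow> 'h set" where
  "E_star M w = {h. column_adjoint M w h = 0}"

definition B1_star ::
    "(complex ^ 'n) set \<Rightarrow> ('n::finite \<Rightarrow> 'h::complex_hilbert \<Rightarrow> 'h) set" where
  "B1_star \<Omega> =
     {M. hilbert_module M \<and>
         (\<forall>w\<in>\<Omega>. closed (range (column_adjoint M w))) \<and>
         (\<forall>w\<in>\<Omega>. complex_space.dim (E_star M w) = 1) \<and>
         closure (complex_space.span (\<Union>w\<in>\<Omega>. E_star M w)) = UNIV}"

text \<open>The operator \<open>T\<close> is multiplication by \<open>\<phi>\<close>. Values of \<open>\<phi>\<close> outside \<open>\<Omega>\<close> are irrelevant.\<close>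

definition is_mult_op ::
    "(complex ^ 'n) set \<Rightarrow> ('n::finite \<Rightarrow> 'h::complex_hilbert \<Rightarrow> 'h) \<Rightarrow> (complex ^ 'n \<Rightarrow> complex)
      \<Rightarrow> ('h \<Rightarrow> 'h) \<Rightarrow> bool" where
  "is_mult_op \<Omega> M \<phi> T \<longleftrightarrow>
     bounded_clinear T \<and> (\<forall>w\<in>\<Omega>. \<forall>k\<in>E_star M w. cadjoint T k = cnj (\<phi> w) *\<^sub>C k)"

definition multipliers ::
    "(complex ^ 'n) set \<Rightarrow> ('n::finite \<Rightarrow> 'h::complex_hilbert \<Rightarrow> 'h) \<Rightarrow> (complex ^ 'n \<Rightarrow> complex) set"
  where "multipliers \<Omega> M = {\<phi>. \<exists>T. is_mult_op \<Omega> M \<phi> T}"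

text \<open>For a module in \<^const>\<open>B1_star\<close> the operator is unique, because the spaces
  \<^term>\<open>E_star M w\<close> span a dense subspace.\<close>

definition mult_op ::
    "(complex ^ 'n) set \<Rightarrow> ('n::finite \<Rightarrow> 'h::complex_hilbert \<Rightarrow> 'h) \<Rightarrow> (complex ^ 'n \<Rightarrow> complex)
      \<Rightarrow> 'h \<Rightarrow> 'h" where
  "mult_op \<Omega> M \<phi> = (THE T. is_mult_op \<Omega> M \<phi> T)"

definition matrix_multipliers ::
    "(complex ^ 'n) set \<Rightarrow> ('n::finite \<Rightarrow> 'h::complex_hilbert \<Rightarrow> 'h)
      \<Rightarrow> (complex ^ 'n \<Rightarrow> complex ^ 'p ^ 'q) set" where
  "matrix_multipliers \<Omega> M = {\<Theta>. \<forall>i j. (\<lambda>w. \<Theta> w $ i $ j) \<in> multipliers \<Omega> M}"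

definition matrix_mult_op ::
    "(complex ^ 'n) set \<Rightarrow> ('n::finite \<Rightarrow> 'h::complex_hilbert \<Rightarrow> 'h)
      \<Rightarrow> (complex ^ 'n \<Rightarrow> complex ^ 'p ^ 'q) \<Rightarrow> 'h ^ 'p \<Rightarrow> 'h ^ 'q" where
  "matrix_mult_op \<Omega> M \<Theta> x = (\<chi> i. \<Sum>j\<in>UNIV. mult_op \<Omega> M (\<lambda>w. \<Theta> w $ i $ j) (x $ j))"

text \<open>\<open>\<H>\<^sub>\<Theta>\<close>, the quotient of the tensor product with complex \<open>q\<close>-space by the range of the
  multiplication operator.\<close>

definition quotient_by ::
    "(complex ^ 'n) set \<Rightarrow> ('n::finite \<Rightarrow> 'h::complex_hilbert \<Rightarrow> 'h)
      \<Rightarrow> (complex ^ 'n \<Rightarrow> complex ^ 'p ^ 'q) \<Rightarrow> ('n, ('h ^ 'q) set) normed_module" where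
  "quotient_by \<Omega> M \<Theta> = quotient_module (tensor_action M) (range (matrix_mult_op \<Omega> M \<Theta>))"

end

theory Submission
  imports Defs
begin

text \<open>Let \<open>\<Psi>\<close> be a left inverse of \<open>\<Theta>\<close>. Then \<open>P = M\<^sub>\<Theta> M\<^sub>\<Psi>\<close> is an idempotent module map with the same
  range as \<open>M\<^sub>\<Theta>\<close>, so the quotient is a copy of the complemented submodule of the vectors \<open>x - P x\<close>,
  and a similarity with the \<open>r\<close>-fold power of the module amounts to two bounded module maps \<open>A\<close>, \<open>B\<close>
  between the \<open>q\<close>-fold and the \<open>r\<close>-fold power with \<open>A B = I\<close> and \<open>B A = I - P\<close>
  (\<open>similar_quotient_idempotent_iff\<close>).

  The joint eigenspaces over \<open>\<Omega>\<close> are lines, and the adjoint of a module endomorphism preserves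
  them; hence every module endomorphism is multiplication by a multiplier
  (\<open>intertwiner_is_mult_op\<close>), and \<open>A\<close>, \<open>B\<close> are given by matrices \<open>\<Phi>\<close>, \<open>\<Gamma>\<close> of multipliers. Since the
  eigenvectors span a dense subspace, an identity between such operators is the same as the identity
  between their symbols at every point of \<open>\<Omega>\<close> (\<open>has_symbol_eq_iff\<close>). Similarity is thus equivalent to
  the solvability of \<open>\<Phi> \<Gamma> = I\<close> and \<open>\<Gamma> \<Phi> = I - \<Theta> \<Psi>\<close> on \<open>\<Omega>\<close> in matrices of multipliers
  (\<open>similar_quotient_by_iff\<close>). A solution over the multipliers of the first module is a solution over
  the larger multiplier algebra of the second.

  Reading the eigenvector condition off the inner product requires that adjoints exist, which
  is a consequence of the Riesz representation theorem (\<open>riesz_representation\<close>).\<close>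

section \<open>Inner products and adjoints\<close>

lemma cinner_add_right: "cinner x (y + z) = cinner x y + cinner x z"
  by (metis cinner_add_left cinner_commute complex_cnj_add)

lemma cinner_scaleC_right: "cinner x (c *\<^sub>C y) = cnj c * cinner x y"
  by (metis cinner_commute cinner_scaleC_left complex_cnj_mult)

lemma cinner_zero_left [simp]: "cinner 0 y = 0"
  using cinner_add_left[of 0 0 y] by simp

lemma cinner_zero_right [simp]: "cinner x 0 = 0"
  using cinner_add_right[of x 0 0] by simp

lemma cinner_diff_left: "cinner (x - y) z = cinner x z - cinner y z"
  using cinner_add_left[of "x - y" y z] by (simp add: algebra_simps)

lemma cinner_diff_right: "cinner z (x - y) = cinner z x - cinner z y"
  using cinner_add_right[of z "x - y" y] by (simp add: algebra_simps)

lemma cinner_sum_left: "cinner (sum f A) y = (\<Sum>i\<in>A. cinner (f i) y)"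
  by (induction A rule: infinite_finite_induct) (auto simp: cinner_add_left)

lemma cinner_self_eq_0_iff [simp]: "cinner x x = 0 \<longleftrightarrow> x = 0"
  using inner_eq_Re_cinner[of x x] by (metis cinner_zero_left inner_eq_zero_iff zero_complex.sel(1))

lemma Im_cinner: "Im (cinner x y) = - ((\<i> *\<^sub>C x) \<bullet> y)"
  by (simp add: inner_eq_Re_cinner cinner_scaleC_left)

lemma cinner_right_cancel: "(\<And>x. cinner x y = cinner x z) \<Longrightarrow> y = z"
  by (metis cinner_diff_right cinner_self_eq_0_iff right_minus_eq)

lemma scaleC_diff_right: "c *\<^sub>C (x - y :: 'a::complex_inner) = c *\<^sub>C x - c *\<^sub>C y"
  using scaleC_add_right[of c "x - y" y] by (simp add: algebra_simps)

lemma bounded_linear_scaleC: "bounded_linear (\<lambda>x::'a::complex_inner. c *\<^sub>C x)"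
proof (rule bounded_linear_intro)
  fix x y :: 'a and r :: real
  show "c *\<^sub>C (x + y) = c *\<^sub>C x + c *\<^sub>C y" by (rule scaleC_add_right)
  show "c *\<^sub>C r *\<^sub>R x = r *\<^sub>R c *\<^sub>C x" by (simp add: scaleR_scaleC scaleC_scaleC mult.commute)
  have "(norm (c *\<^sub>C x))\<^sup>2 = Re (c * (cnj c * cinner x x))"
    by (simp add: power2_norm_eq_inner inner_eq_Re_cinner cinner_scaleC_left cinner_scaleC_right
        algebra_simps)
  also have "c * (cnj c * cinner x x) = complex_of_real ((norm c)\<^sup>2) * cinner x x"
    unfolding complex_norm_square by (simp only: mult.assoc)
  also have "Re \<dots> = (norm x * norm c)\<^sup>2"
    by (simp only: Re_complex_of_real power_mult_distrib times_complex.sel Im_complex_of_real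
        power2_norm_eq_inner[of x] inner_eq_Re_cinner) simp
  finally show "norm (c *\<^sub>C x) \<le> norm x * norm c"
    by (rule power2_le_imp_le[OF eq_refl]) simp
qed

text \<open>The functional is represented by the minimiser of the energy
  \<^term>\<open>(norm x)\<^sup>2 / 2 - f x\<close>: the parallelogram law makes every minimising sequence a Cauchy
  sequence, and the derivative of the energy at the minimiser \<open>a\<close> in the direction \<open>v\<close> is
  \<^term>\<open>v \<bullet> a - f v\<close>.\<close>

lemma riesz_representation:
  fixes f :: "'a::{real_inner, complete_space} \<Rightarrow> real"
  assumes f: "bounded_linear f"
  shows "\<exists>a. \<forall>x. f x = x \<bullet> a"
proof -
  interpret f: bounded_linear f by fact
  define g where "g x = (norm x)\<^sup>2 / 2 - f x" for x
  obtain K where K: "\<And>x. norm (f x) \<le> norm x * K" using f.bounded by blast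
  have below: "g x \<ge> - K\<^sup>2 / 2" for x
  proof -
    have "f x \<le> norm x * K" using K[of x] by simp
    moreover have "0 \<le> (norm x - K)\<^sup>2" by simp
    ultimately show ?thesis by (simp add: g_def power2_eq_square algebra_simps)
  qed
  define m where "m = Inf (range g)"
  have bdd: "bdd_below (range g)" by (rule bdd_belowI2[of _ "- K\<^sup>2 / 2"]) (rule below)
  have m_le: "m \<le> g x" for x unfolding m_def using bdd by (auto intro: cInf_lower)
  have "\<exists>x. g x < m + e" if "e > 0" for e
    using cInf_less_iff[OF _ bdd, of "m + e"] that unfolding m_def by auto
  then have "\<forall>n. \<exists>x. g x < m + 1 / Suc n" by simp
  then obtain X where X: "\<And>n. g (X n) < m + 1 / Suc n" by metis
  have par: "(norm (x - y))\<^sup>2 / 4 = g x + g y - 2 * g ((1/2) *\<^sub>R (x + y))" for x y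
    by (simp add: g_def f.add f.scaleR power2_norm_eq_inner inner_simps inner_commute field_simps)
  have close: "(norm (X i - X j))\<^sup>2 \<le> 4 * (1 / Suc i + 1 / Suc j)" for i j
  proof -
    have "b \<le> 4 * (s + t)" if "b / 4 = p + q - 2 * r" "p < m + s" "q < m + t" "m \<le> r"
      for b p q r s t :: real
      using that by simp
    from this[OF par X X m_le] show ?thesis .
  qed
  have "Cauchy X"
  proof (rule metric_CauchyI)
    fix e :: real assume e: "e > 0"
    then have "e\<^sup>2 / 8 > 0" by simp
    then obtain N where N: "1 / Suc N < e\<^sup>2 / 8" using nat_approx_posE by metis
    show "\<exists>N. \<forall>i\<ge>N. \<forall>j\<ge>N. dist (X i) (X j) < e"
    proof (intro exI allI impI)
      fix i j assume "i \<ge> N" "j \<ge> N"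
      then have "1 / Suc i \<le> 1 / Suc N" "1 / Suc j \<le> 1 / Suc N" by (simp_all add: frac_le)
      then have "(norm (X i - X j))\<^sup>2 < e\<^sup>2" using N close[of i j] by argo
      then show "dist (X i) (X j) < e" using e by (simp add: dist_norm power2_less_imp_less)
    qed
  qed
  then obtain a where a: "X \<longlonglongrightarrow> a" using Cauchy_convergent convergent_def by blast
  have "(\<lambda>n. g (X n)) \<longlonglongrightarrow> g a"
    unfolding g_def by (intro tendsto_intros a f.tendsto) simp
  moreover have "(\<lambda>n. m + 1 / Suc n) \<longlonglongrightarrow> m"
    using tendsto_add[OF tendsto_const[of m] LIMSEQ_inverse_real_of_nat]
    by (simp add: inverse_eq_divide)
  ultimately have "g a \<le> m" using X by (intro LIMSEQ_le) (auto intro: less_imp_le)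
  then have min: "g a \<le> g x" for x using m_le order_trans by blast
  have "f v = v \<bullet> a" for v
  proof -
    define d where "d = v \<bullet> a - f v"
    have "0 \<le> t * d + t\<^sup>2 * (v \<bullet> v) / 2" for t
    proof -
      have "g (a + t *\<^sub>R v) = g a + (t * d + t\<^sup>2 * (v \<bullet> v) / 2)"
        unfolding g_def d_def power2_norm_eq_inner
        by (simp add: f.add f.scaleR inner_simps inner_commute field_simps power2_eq_square)
      then show ?thesis using min[of "a + t *\<^sub>R v"] by simp
    qed
    \<comment> \<open>This \<open>t\<close> makes the linear term dominate; the \<open>+ 1\<close> guards against \<open>v = 0\<close>.\<close>
    from this[of "- d / (v \<bullet> v + 1)"]
    have "0 \<le> (- d / (v \<bullet> v + 1)) * d + (- d / (v \<bullet> v + 1))\<^sup>2 * (v \<bullet> v) / 2" .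
    also have "\<dots> = - d\<^sup>2 * (v \<bullet> v + 2) / (2 * (v \<bullet> v + 1)\<^sup>2)"
      using inner_ge_zero[of v] by (simp add: field_simps power2_eq_square add_nonneg_eq_0_iff)
    finally have "d\<^sup>2 * (v \<bullet> v + 2) \<le> 0"
      using inner_ge_zero[of v] by (simp add: divide_simps add_nonneg_eq_0_iff split: if_splits)
    then have "d = 0" using inner_ge_zero[of v] by (simp add: mult_le_0_iff)
    then show ?thesis by (simp add: d_def)
  qed
  then show ?thesis by blast
qed

lemma cinner_cadjoint:
  fixes T :: "'a::complex_hilbert \<Rightarrow> 'b::complex_inner"
  assumes T: "bounded_clinear T"
  shows "cinner (T x) y = cinner x (cadjoint T y)"
proof -
  have lin: "bounded_linear T" and sc: "\<And>c x. T (c *\<^sub>C x) = c *\<^sub>C T x"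
    using T by (auto simp: bounded_clinear_def)
  have "\<exists>a. \<forall>x. T x \<bullet> y = x \<bullet> a" for y
    using riesz_representation[OF bounded_linear_compose[OF bounded_linear_inner_left lin]] by simp
  then obtain S where S: "\<And>x y. T x \<bullet> y = x \<bullet> S y" by metis
  have "cinner (T x) y = cinner x (S y)" for x y
    by (simp add: complex_eq_iff Im_cinner S flip: inner_eq_Re_cinner sc)
  then have "\<exists>S. \<forall>x y. cinner (T x) y = cinner x (S y)" by blast
  from someI_ex[OF this] show ?thesis unfolding cadjoint_def by blast
qed

lemma cadjoint_eq_iff:
  fixes T :: "'a::complex_hilbert \<Rightarrow> 'b::complex_inner"
  assumes "bounded_clinear T"
  shows "cadjoint T y = z \<longleftrightarrow> (\<forall>x. cinner (T x) y = cinner x z)"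
  using cinner_cadjoint[OF assms] cinner_right_cancel by metis


section \<open>Bounded operators between powers of a Hilbert space\<close>

lemma bounded_clinear_compose:
  "bounded_clinear S \<Longrightarrow> bounded_clinear T \<Longrightarrow> bounded_clinear (\<lambda>x. S (T x))"
  by (auto simp: bounded_clinear_def bounded_linear_compose)

lemma bounded_clinear_diff:
  "bounded_clinear S \<Longrightarrow> bounded_clinear T \<Longrightarrow> bounded_clinear (\<lambda>x. S x - T x)"
  by (auto simp: bounded_clinear_def bounded_linear_sub scaleC_diff_right)

lemma bounded_clinear_id: "bounded_clinear (\<lambda>x. x)"
  by (simp add: bounded_clinear_def bounded_linear_ident)

lemma bounded_clinear_zero: "bounded_clinear (\<lambda>x. 0)"
  by (simp add: bounded_clinear_def)

lemma bounded_clinear_scaleC: "bounded_clinear (\<lambda>x. c *\<^sub>C x)"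
  by (simp add: bounded_clinear_def bounded_linear_scaleC scaleC_scaleC mult.commute)

lemma bounded_clinear_sum:
  assumes "\<And>i. i \<in> A \<Longrightarrow> bounded_clinear (f i)"
  shows "bounded_clinear (\<lambda>x. \<Sum>i\<in>A. f i x)"
  using assms
  by (simp add: bounded_clinear_def bounded_linear_sum complex_space.scale_sum_right)

lemma bounded_clinear_bound:
  assumes "bounded_clinear T"
  shows "\<exists>K>0. \<forall>x. norm (T x) \<le> norm x * K"
  using assms bounded_linear.pos_bounded[of T] unfolding bounded_clinear_def by blast

lemma bounded_clinear_add: "bounded_clinear T \<Longrightarrow> T (x + y) = T x + T y"
  by (simp add: bounded_clinear_def bounded_linear.linear linear_add)

lemma bounded_clinear_diff_arg: "bounded_clinear T \<Longrightarrow> T (x - y) = T x - T y"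
  by (simp add: bounded_clinear_def bounded_linear.linear linear_diff)

lemma bounded_clinear_0: "bounded_clinear T \<Longrightarrow> T 0 = 0"
  by (simp add: bounded_clinear_def bounded_linear.linear linear_0)

lemma bounded_clinear_scale_arg: "bounded_clinear T \<Longrightarrow> T (c *\<^sub>C x) = c *\<^sub>C T x"
  by (simp add: bounded_clinear_def)

lemma bounded_clinear_sum_arg: "bounded_clinear T \<Longrightarrow> T (sum f A) = (\<Sum>i\<in>A. T (f i))"
  by (simp add: bounded_clinear_def bounded_linear.linear linear_sum)

lemma bounded_clinear_vec_nth: "bounded_clinear (\<lambda>x. x $ i)"
  by (simp add: bounded_clinear_def bounded_linear_vec_nth scaleC_vec_def)

lemma bounded_clinear_vec_lambda:
  fixes f :: "'m::finite \<Rightarrow> 'a::complex_inner \<Rightarrow> 'b::complex_inner"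
  assumes f: "\<And>i. bounded_clinear (f i)"
  shows "bounded_clinear (\<lambda>x. \<chi> i. f i x)"
proof -
  have "\<exists>K. \<forall>x. norm (f i x) \<le> norm x * K" for i
    using f[of i] by (auto simp: bounded_clinear_def dest: bounded_linear.bounded)
  then obtain K where K: "\<And>i x. norm (f i x) \<le> norm x * K i" by metis
  have lin: "linear (f i)" for i
    using f[of i] by (simp add: bounded_clinear_def bounded_linear.linear)
  have "bounded_linear (\<lambda>x. \<chi> i. f i x)"
  proof (rule bounded_linear_intro)
    fix x
    have "norm (\<chi> i. f i x) \<le> (\<Sum>i\<in>UNIV. norm (f i x))"
      by (simp add: norm_vec_def L2_set_le_sum)
    also have "\<dots> \<le> (\<Sum>i\<in>UNIV. norm x * K i)" by (intro sum_mono K)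
    finally show "norm (\<chi> i. f i x) \<le> norm x * sum K UNIV" by (simp add: sum_distrib_left)
  qed (simp_all add: vec_eq_iff linear_add[OF lin] linear_scale[OF lin])
  then show ?thesis
    using f by (simp add: bounded_clinear_def scaleC_vec_def vec_eq_iff)
qed

lemma bounded_clinear_axis:
  "bounded_clinear (axis j :: 'a::complex_inner \<Rightarrow> 'a ^ 'm::finite)"
proof -
  have "bounded_clinear (\<lambda>x::'a. if i = j then x else 0)" for i :: 'm
    using bounded_clinear_id bounded_clinear_zero by (cases "i = j") auto
  then show ?thesis unfolding axis_def[abs_def] by (rule bounded_clinear_vec_lambda)
qed

lemma sum_axis_components: "(\<Sum>j\<in>UNIV. axis j (x $ j)) = (x :: 'a::comm_monoid_add ^ 'm::finite)"
  by (simp add: vec_eq_iff axis_def)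

lemma bounded_clinear_tensor_action:
  assumes "\<And>i. bounded_clinear (M i)"
  shows "bounded_clinear (tensor_action M i :: 'h::complex_hilbert ^ 'm::finite \<Rightarrow> _)"
  unfolding tensor_action_def[abs_def]
  by (intro bounded_clinear_vec_lambda bounded_clinear_compose[OF assms] bounded_clinear_vec_nth)


section \<open>Quotients by the range of an idempotent module map\<close>

lemma complex_subspace_range:
  assumes "bounded_clinear T"
  shows "complex_space.subspace (range T)"
  unfolding complex_space.subspace_def
  using bounded_clinear_add[OF assms] bounded_clinear_scale_arg[OF assms] bounded_clinear_0[OF assms]
  by (metis (no_types, lifting) rangeE rangeI)

lemma mem_coset_iff: "y \<in> x +o N \<longleftrightarrow> y - x \<in> (N :: 'a::ab_group_add set)"
  by (auto simp: elt_set_plus_def intro!: bexI[of _ "y - x"])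

lemma coset_eq_iff:
  assumes N: "complex_space.subspace N"
  shows "x +o N = y +o N \<longleftrightarrow> x - y \<in> N"
proof
  assume "x +o N = y +o N"
  moreover have "x \<in> x +o N" using N by (simp add: mem_coset_iff complex_space.subspace_def)
  ultimately show "x - y \<in> N" using mem_coset_iff by blast
next
  assume d: "x - y \<in> N"
  have "z - x \<in> N \<longleftrightarrow> z - y \<in> N" for z
  proof
    assume "z - x \<in> N"
    then have "(z - x) + (x - y) \<in> N" using d N unfolding complex_space.subspace_def by blast
    then show "z - y \<in> N" by simp
  next
    assume "z - y \<in> N"
    then have "(z - y) - (x - y) \<in> N" using d N complex_space.subspace_diff by blast
    then show "z - x \<in> N" by simp
  qed
  then show "x +o N = y +o N" by (auto simp: mem_coset_iff)
qed

lemma coset_add: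
  assumes N: "complex_space.subspace N"
  shows "(x +o N) + (y +o N) = (x + y) +o N"
proof -
  have "N + N = N"
  proof
    show "N + N \<subseteq> N" using N by (auto simp: set_plus_def complex_space.subspace_def)
    show "N \<subseteq> N + N"
    proof
      fix n assume "n \<in> N"
      then have "n + 0 \<in> N + N" using N by (intro set_plus_intro) (auto simp: complex_space.subspace_def)
      then show "n \<in> N + N" by simp
    qed
  qed
  then show ?thesis by (simp add: set_plus_rearrange)
qed

lemma coset_image:
  assumes N: "complex_space.subspace N" and L: "bounded_clinear L" and inv: "\<And>n. n \<in> N \<Longrightarrow> L n \<in> N"
  shows "L ` (x +o N) + N = L x +o N"
proof
  show "L ` (x +o N) + N \<subseteq> L x +o N"
  proof
    fix z assume "z \<in> L ` (x +o N) + N"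
    then obtain n n' where *: "n \<in> N" "n' \<in> N" "z = L (x + n) + n'"
      by (auto simp: set_plus_def elt_set_plus_def)
    then have "L n + n' \<in> N" using inv N by (simp add: complex_space.subspace_def)
    then show "z \<in> L x +o N" using * by (simp add: mem_coset_iff bounded_clinear_add[OF L] add.assoc)
  qed
  show "L x +o N \<subseteq> L ` (x +o N) + N"
  proof
    fix z assume "z \<in> L x +o N"
    then have "z - L x \<in> N" by (simp add: mem_coset_iff)
    moreover have "L x \<in> L ` (x +o N)" using N by (auto simp: mem_coset_iff complex_space.subspace_def)
    ultimately have "L x + (z - L x) \<in> L ` (x +o N) + N" by (rule set_plus_intro[rotated])
    then show "z \<in> L ` (x +o N) + N" by simp
  qed
qed

lemma module_map_compose:
  assumes T: "module_map A B T" and S: "module_map B C S" and nn: "\<And>y. y \<in> mcarrier B \<Longrightarrow> 0 \<le> mnorm B y"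
  shows "module_map A C (\<lambda>x. S (T x))"
proof -
  obtain K where K: "\<And>x. x \<in> mcarrier A \<Longrightarrow> mnorm B (T x) \<le> K * mnorm A x"
    using T unfolding module_map_def by blast
  obtain J where J: "\<And>y. y \<in> mcarrier B \<Longrightarrow> mnorm C (S y) \<le> J * mnorm B y"
    using S unfolding module_map_def by blast
  have c: "\<And>x. x \<in> mcarrier A \<Longrightarrow> T x \<in> mcarrier B"
    using T by (auto simp: module_map_def)
  have "mnorm C (S (T x)) \<le> (\<bar>J\<bar> * K) * mnorm A x" if x: "x \<in> mcarrier A" for x
  proof -
    have "mnorm C (S (T x)) \<le> \<bar>J\<bar> * mnorm B (T x)"
      using J[OF c[OF x]] nn[OF c[OF x]] by (meson abs_ge_self mult_right_mono order_trans)
    also have "\<dots> \<le> \<bar>J\<bar> * (K * mnorm A x)" using K[OF x] by (simp add: mult_left_mono)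
    finally show ?thesis by (simp add: mult.assoc)
  qed
  then have "\<exists>K. \<forall>x\<in>mcarrier A. mnorm C (S (T x)) \<le> K * mnorm A x" by blast
  then show ?thesis
    using S T c by (auto simp: module_map_def image_subset_iff)
qed

lemma module_map_full_iff:
  "module_map (full_module L) (full_module L') T \<longleftrightarrow>
     bounded_clinear T \<and> (\<forall>i x. T (L i x) = L' i (T x))"
proof
  assume "module_map (full_module L) (full_module L') T"
  then have add: "\<And>x y. T (x + y) = T x + T y" and sc: "\<And>c x. T (c *\<^sub>C x) = c *\<^sub>C T x"
    and act: "\<And>i x. T (L i x) = L' i (T x)" and "\<exists>K. \<forall>x. norm (T x) \<le> K * norm x"
    by (auto simp: module_map_def full_module_def)
  then obtain K where K: "\<And>x. norm (T x) \<le> K * norm x" by blast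
  have "bounded_linear T"
    by (rule bounded_linear_intro[of _ K]) (use add sc K in \<open>auto simp: scaleR_scaleC mult.commute\<close>)
  then show "bounded_clinear T \<and> (\<forall>i x. T (L i x) = L' i (T x))"
    using sc act by (simp add: bounded_clinear_def)
next
  assume *: "bounded_clinear T \<and> (\<forall>i x. T (L i x) = L' i (T x))"
  then have "\<exists>K. \<forall>x. norm (T x) \<le> K * norm x"
    using bounded_clinear_bound[of T] by (metis mult.commute)
  then show "module_map (full_module L) (full_module L') T"
    using * by (auto simp: module_map_def full_module_def bounded_clinear_add bounded_clinear_scale_arg)
qed

context
  fixes L :: "'n \<Rightarrow> 'h::complex_hilbert \<Rightarrow> 'h" and N :: "'h set"
  assumes N: "complex_space.subspace N" and L: "\<And>i. bounded_clinear (L i)"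
    and inv: "\<And>i n. n \<in> N \<Longrightarrow> L i n \<in> N"
begin

lemma quotient_scale: "(*\<^sub>C) c ` (x +o N) + N = c *\<^sub>C x +o N"
  by (rule coset_image[OF N bounded_clinear_scaleC]) (use N in \<open>auto simp: complex_space.subspace_def\<close>)

lemma quotient_norm_nonneg: "0 \<le> Inf (norm ` (x +o N))"
  using N by (intro cInf_greatest) (auto simp: mem_coset_iff complex_space.subspace_def elt_set_plus_def)

lemma module_map_projection: "module_map (full_module L) (quotient_module L N) (\<lambda>x. x +o N)"
proof -
  have "Inf (norm ` (x +o N)) \<le> norm x" for x
  proof (rule cInf_lower)
    show "norm x \<in> norm ` (x +o N)" using N by (auto simp: mem_coset_iff complex_space.subspace_def)
  qed (auto intro: bdd_belowI[of _ 0])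
  then have "\<exists>K. \<forall>x. Inf (norm ` (x +o N)) \<le> K * norm x" by (metis mult_1)
  then show ?thesis
    by (auto simp: module_map_def full_module_def quotient_module_def coset_add[OF N] quotient_scale
        coset_image[OF N L inv])
qed

text \<open>The universal property of the quotient. The lift is as bounded as \<open>F\<close>, because \<open>F\<close> takes the
  same value at every representative, in particular at those of nearly minimal norm.\<close>

lemma module_map_lift:
  assumes F: "bounded_clinear F" and int: "\<And>i x. F (L i x) = L' i (F x)"
    and ker: "\<And>n. n \<in> N \<Longrightarrow> F n = 0"
  shows "\<exists>T. module_map (quotient_module L N) (full_module L') T \<and> (\<forall>x. T (x +o N) = F x)"
proof -
  define T where "T C = F (SOME c. c \<in> C)" for C
  have T: "T (x +o N) = F x" for x
  proof -
    have "x \<in> x +o N" using N by (simp add: mem_coset_iff complex_space.subspace_def)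
    then have "(SOME c. c \<in> x +o N) \<in> x +o N" by (rule someI)
    then have "F ((SOME c. c \<in> x +o N) - x) = 0" by (intro ker) (simp add: mem_coset_iff)
    then show ?thesis by (simp add: T_def bounded_clinear_diff_arg[OF F])
  qed
  obtain K where "K > 0" and K: "\<And>x. norm (F x) \<le> norm x * K"
    using bounded_clinear_bound[OF F] by blast
  have "norm (F x) \<le> K * Inf (norm ` (x +o N))" for x
  proof -
    have "norm (F x) / K \<le> Inf (norm ` (x +o N))"
    proof (rule cInf_greatest)
      fix r assume "r \<in> norm ` (x +o N)"
      then obtain n where n: "n \<in> N" "r = norm (x + n)" by (auto simp: elt_set_plus_def)
      then have "F (x + n) = F x" by (simp add: bounded_clinear_add[OF F] ker)
      then show "norm (F x) / K \<le> r" using K[of "x + n"] n \<open>K > 0\<close> by (simp add: field_simps)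
    qed (use N in \<open>auto simp: complex_space.subspace_def elt_set_plus_def\<close>)
    then show ?thesis using \<open>K > 0\<close> by (simp add: field_simps)
  qed
  then have "\<exists>K. \<forall>x. norm (F x) \<le> K * Inf (norm ` (x +o N))" by blast
  then have "module_map (quotient_module L N) (full_module L') T"
    by (auto simp: module_map_def full_module_def quotient_module_def coset_add[OF N] quotient_scale
        coset_image[OF N L inv] T bounded_clinear_add[OF F] bounded_clinear_scale_arg[OF F] int)
  then show ?thesis using T by blast
qed

end

text \<open>An idempotent module map \<open>P\<close> splits the quotient by its range: the coset of \<open>x\<close> has
  the canonical representative \<^term>\<open>x - P x\<close>, which depends on the coset alone. Similarity with
  another module therefore becomes a pair of identities between bounded operators on the ambient
  spaces, without any reference to cosets.\<close>

lemma similar_quotient_idempotent_iff: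
  fixes L :: "'n \<Rightarrow> 'h::complex_hilbert \<Rightarrow> 'h" and L' :: "'n \<Rightarrow> 'k::complex_hilbert \<Rightarrow> 'k"
  assumes L: "\<And>i. bounded_clinear (L i)" and P: "bounded_clinear P"
    and idem: "\<And>x. P (P x) = P x" and int: "\<And>i x. P (L i x) = L i (P x)"
  shows "similar_modules (quotient_module L (range P)) (full_module L') \<longleftrightarrow>
    (\<exists>A B. bounded_clinear A \<and> bounded_clinear B \<and>
       (\<forall>i x. A (L i x) = L' i (A x)) \<and> (\<forall>i y. B (L' i y) = L i (B y)) \<and>
       (\<forall>y. A (B y) = y) \<and> (\<forall>x. B (A x) = x - P x))"
    (is "?lhs \<longleftrightarrow> ?rhs")
proof -
  define N where "N = range P"
  have N: "complex_space.subspace N" unfolding N_def by (rule complex_subspace_range[OF P])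
  have inv: "\<And>i n. n \<in> N \<Longrightarrow> L i n \<in> N" by (auto simp: N_def simp flip: int)
  have PN: "P x \<in> N" for x by (simp add: N_def)
  have rep: "(x - P x) +o N = x +o N" for x
    using complex_space.subspace_diff[OF N _ PN, of 0 x] N
    by (simp add: coset_eq_iff[OF N] complex_space.subspace_def)
  note proj = module_map_projection[OF N L inv]
  have nonneg: "0 \<le> mnorm (quotient_module L N) C" if "C \<in> mcarrier (quotient_module L N)" for C
    using that quotient_norm_nonneg[OF N L inv] by (auto simp: quotient_module_def)
  have carr: "mcarrier (quotient_module L N) = range (\<lambda>x. x +o N)" "mcarrier (full_module L') = UNIV"
    by (simp_all add: quotient_module_def full_module_def)
  show ?thesis
  proof
    assume ?lhs
    then obtain T S where T: "module_map (quotient_module L N) (full_module L') T"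
      and S: "module_map (full_module L') (quotient_module L N) S"
      and ST: "\<And>x. S (T (x +o N)) = x +o N" and TS: "\<And>y. T (S y) = y"
      by (auto simp: similar_modules_def carr simp flip: N_def)
    have bQ: "bounded_clinear (\<lambda>x. x - P x)" by (rule bounded_clinear_diff[OF bounded_clinear_id P])
    have iQ: "L i x - P (L i x) = L i (x - P x)" for i x
      by (simp add: bounded_clinear_diff_arg[OF L] int)
    have kQ: "n - P n = 0" if "n \<in> N" for n using that by (auto simp: N_def idem)
    obtain Q where Q: "module_map (quotient_module L N) (full_module L) Q"
      and Qx: "\<And>x. Q (x +o N) = x - P x"
      using module_map_lift[where F = "\<lambda>x. x - P x" and L' = L, OF N L inv bQ iQ kQ] by blast
    have A: "module_map (full_module L) (full_module L') (\<lambda>x. T (x +o N))"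
      by (rule module_map_compose[OF proj T nonneg])
    have B: "module_map (full_module L') (full_module L) (\<lambda>y. Q (S y))"
      by (rule module_map_compose[OF S Q nonneg])
    have "T (Q (S y) +o N) = y" for y
    proof -
      have "S y \<in> range (\<lambda>x. x +o N)"
        using S by (auto simp: module_map_def carr)
      then obtain x where "S y = x +o N" by auto
      then show ?thesis using TS[of y] by (simp add: Qx rep)
    qed
    moreover have "Q (S (T (x +o N))) = x - P x" for x by (simp add: ST Qx)
    ultimately show ?rhs
      using A B unfolding module_map_full_iff
      by (intro exI[of _ "\<lambda>x. T (x +o N)"] exI[of _ "\<lambda>y. Q (S y)"]) simp
  next
    assume ?rhs
    then obtain A B where A: "bounded_clinear A" and B: "bounded_clinear B"
      and Ai: "\<And>i x. A (L i x) = L' i (A x)" and Bi: "\<And>i y. B (L' i y) = L i (B y)"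
      and AB: "\<And>y. A (B y) = y" and BA: "\<And>x. B (A x) = x - P x" by blast
    have "A (P x) = 0" for x
    proof -
      have "A x = A (B (A x))" by (simp add: AB)
      then show ?thesis by (simp add: BA bounded_clinear_diff_arg[OF A])
    qed
    then have kA: "A n = 0" if "n \<in> N" for n using that by (auto simp: N_def)
    obtain T where T: "module_map (quotient_module L N) (full_module L') T"
      and Tx: "\<And>x. T (x +o N) = A x"
      using module_map_lift[where F = A and L' = L', OF N L inv A Ai kA] by blast
    have B': "module_map (full_module L') (full_module L) B"
      using B Bi by (simp add: module_map_full_iff)
    have "0 \<le> mnorm (full_module L) y" for y by (simp add: full_module_def)
    then have S: "module_map (full_module L') (quotient_module L N) (\<lambda>y. B y +o N)"
      using module_map_compose[OF B' proj] by blast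
    show ?lhs unfolding similar_modules_def N_def[symmetric]
      using T S by (intro exI[of _ T] exI[of _ "\<lambda>y. B y +o N"]) (auto simp: carr Tx AB BA rep)
  qed
qed


section \<open>Multipliers and symbols\<close>

lemma is_mult_op_iff:
  "is_mult_op \<Omega> M \<phi> T \<longleftrightarrow>
     bounded_clinear T \<and> (\<forall>w\<in>\<Omega>. \<forall>k\<in>E_star M w. \<forall>x. cinner (T x) k = \<phi> w * cinner x k)"
  by (auto simp: is_mult_op_def cadjoint_eq_iff cinner_scaleC_right)

lemma mem_E_star_iff:
  assumes "\<And>i. bounded_clinear (M i)"
  shows "k \<in> E_star M w \<longleftrightarrow> (\<forall>i x. cinner (M i x) k = w $ i * cinner x k)"
proof -
  have "bounded_clinear (\<lambda>x. M i x - (w $ i) *\<^sub>C x)" for i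
    by (rule bounded_clinear_diff[OF assms bounded_clinear_scaleC])
  then show ?thesis
    by (simp add: E_star_def column_adjoint_def vec_eq_iff cadjoint_eq_iff cinner_diff_left
        cinner_scaleC_left)
qed

text \<open>The value of a vector of module elements at a point of \<open>\<Omega>\<close>, when \<open>k\<close> spans the joint
  eigenspace there: this is how the elements of \<^typ>\<open>'h ^ 'm\<close> become functions on \<open>\<Omega>\<close>.\<close>

definition evaluation :: "'h::complex_inner \<Rightarrow> 'h ^ 'm::finite \<Rightarrow> complex ^ 'm" where
  "evaluation k x = (\<chi> j. cinner (x $ j) k)"

lemma evaluation_diff: "evaluation k (x - y) = evaluation k x - evaluation k y"
  by (simp add: evaluation_def vec_eq_iff cinner_diff_left)

lemma evaluation_surj:
  assumes "k \<noteq> 0"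
  obtains x where "evaluation k x = v"
proof
  show "evaluation k (\<chi> j. (v $ j / cinner k k) *\<^sub>C k) = v"
    using assms by (simp add: evaluation_def vec_eq_iff cinner_scaleC_left)
qed

definition has_symbol ::
    "(complex ^ 'n) set \<Rightarrow> ('n::finite \<Rightarrow> 'h::complex_hilbert \<Rightarrow> 'h)
      \<Rightarrow> (complex ^ 'n \<Rightarrow> complex ^ 'p::finite ^ 'q::finite) \<Rightarrow> ('h ^ 'p \<Rightarrow> 'h ^ 'q) \<Rightarrow> bool" where
  "has_symbol \<Omega> M \<Phi> F \<longleftrightarrow> bounded_clinear F \<and>
     (\<forall>w\<in>\<Omega>. \<forall>k\<in>E_star M w. \<forall>x. evaluation k (F x) = \<Phi> w *v evaluation k x)"

lemma has_symbol_compose: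
  "has_symbol \<Omega> M \<Phi> F \<Longrightarrow> has_symbol \<Omega> M \<Gamma> G \<Longrightarrow> has_symbol \<Omega> M (\<lambda>w. \<Phi> w ** \<Gamma> w) (\<lambda>x. F (G x))"
  by (simp add: has_symbol_def bounded_clinear_compose matrix_vector_mul_assoc)

lemma has_symbol_diff:
  "has_symbol \<Omega> M \<Phi> F \<Longrightarrow> has_symbol \<Omega> M \<Gamma> G \<Longrightarrow> has_symbol \<Omega> M (\<lambda>w. \<Phi> w - \<Gamma> w) (\<lambda>x. F x - G x)"
  by (simp add: has_symbol_def bounded_clinear_diff evaluation_diff matrix_vector_mult_diff_rdistrib)

lemma has_symbol_id: "has_symbol \<Omega> M (\<lambda>w. mat 1) (\<lambda>x. x)"
  by (simp add: has_symbol_def bounded_clinear_id)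

context
  fixes \<Omega> :: "(complex ^ 'n::finite) set" and M :: "'n \<Rightarrow> 'h::complex_hilbert \<Rightarrow> 'h"
  assumes M: "M \<in> B1_star \<Omega>"
begin

lemma B1_star_bounded: "bounded_clinear (M i)"
  using M by (simp add: B1_star_def hilbert_module_def)

lemma B1_star_generator:
  assumes "w \<in> \<Omega>"
  obtains k where "k \<noteq> 0" "E_star M w = range (\<lambda>c. c *\<^sub>C k)"
proof -
  have "complex_space.subspace (E_star M w)"
    unfolding complex_space.subspace_def
    by (simp add: mem_E_star_iff[OF B1_star_bounded] cinner_add_right cinner_scaleC_right
        algebra_simps)
  then have span: "complex_space.span (E_star M w) = E_star M w" by simp
  have dim: "complex_space.dim (E_star M w) = 1" using M assms by (simp add: B1_star_def)
  obtain b where b: "\<not> complex_space.dependent b" "complex_space.span b = complex_space.span (E_star M w)"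
      "card b = complex_space.dim (E_star M w)"
    using complex_space.basis_exists
    by (metis complex_space.span_mono complex_space.span_span span subset_antisym)
  then obtain k where k: "b = {k}" using dim by (metis card_1_singletonE)
  then have "k \<noteq> 0" using b(1) complex_space.dependent_zero by auto
  moreover have "E_star M w = range (\<lambda>c. c *\<^sub>C k)"
    using b(2) k span by (simp add: complex_space.span_singleton)
  ultimately show ?thesis using that by blast
qed

text \<open>An element orthogonal to all the joint eigenvectors is orthogonal to a dense subspace.\<close>

lemma B1_star_separating:
  assumes "\<And>w k. w \<in> \<Omega> \<Longrightarrow> k \<in> E_star M w \<Longrightarrow> cinner x k = cinner y k"
  shows "x = y"
proof -
  let ?z = "x - y"
  have "cinner ?z k = 0" if "k \<in> complex_space.span (\<Union>w\<in>\<Omega>. E_star M w)" for k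
    using that
    by (induction rule: complex_space.span_induct_alt)
      (auto simp: cinner_add_right cinner_scaleC_right cinner_diff_left assms)
  then have "complex_space.span (\<Union>w\<in>\<Omega>. E_star M w) \<subseteq> {k. ?z \<bullet> k = 0}"
    by (auto simp: inner_eq_Re_cinner)
  then have "closure (complex_space.span (\<Union>w\<in>\<Omega>. E_star M w)) \<subseteq> {k. ?z \<bullet> k = 0}"
    by (rule closure_minimal) (rule closed_hyperplane)
  moreover have "closure (complex_space.span (\<Union>w\<in>\<Omega>. E_star M w)) = UNIV"
    using M by (simp add: B1_star_def)
  ultimately have "?z \<in> {k. ?z \<bullet> k = 0}" by blast
  then show ?thesis by simp
qed

lemma is_mult_op_mult_op:
  assumes "\<phi> \<in> multipliers \<Omega> M"
  shows "is_mult_op \<Omega> M \<phi> (mult_op \<Omega> M \<phi>)"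
  unfolding mult_op_def
proof (rule theI'[where P = "is_mult_op \<Omega> M \<phi>"])
  obtain T where T: "is_mult_op \<Omega> M \<phi> T" using assms by (auto simp: multipliers_def)
  moreover have "S = T" if "is_mult_op \<Omega> M \<phi> S" for S
    using that T by (intro ext B1_star_separating) (simp add: is_mult_op_iff)
  ultimately show "\<exists>!T. is_mult_op \<Omega> M \<phi> T" by blast
qed

lemma has_symbol_matrix_mult_op:
  fixes \<Phi> :: "complex ^ 'n \<Rightarrow> complex ^ 'p::finite ^ 'q::finite"
  assumes "\<Phi> \<in> matrix_multipliers \<Omega> M"
  shows "has_symbol \<Omega> M \<Phi> (matrix_mult_op \<Omega> M \<Phi>)"
proof -
  have *: "is_mult_op \<Omega> M (\<lambda>w. \<Phi> w $ i $ j) (mult_op \<Omega> M (\<lambda>w. \<Phi> w $ i $ j))" for i j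
    using assms by (intro is_mult_op_mult_op) (simp add: matrix_multipliers_def)
  then have "bounded_clinear (mult_op \<Omega> M (\<lambda>w. \<Phi> w $ i $ j))" for i j
    by (simp add: is_mult_op_iff)
  then have "bounded_clinear (matrix_mult_op \<Omega> M \<Phi>)"
    unfolding matrix_mult_op_def[abs_def]
    by (intro bounded_clinear_vec_lambda bounded_clinear_sum)
      (blast intro: bounded_clinear_compose[OF _ bounded_clinear_vec_nth])
  moreover have "evaluation k (matrix_mult_op \<Omega> M \<Phi> x) = \<Phi> w *v evaluation k x"
    if "w \<in> \<Omega>" "k \<in> E_star M w" for w k x
    using * that
    by (simp add: is_mult_op_iff evaluation_def matrix_mult_op_def vec_eq_iff matrix_vector_mult_def
        cinner_sum_left)
  ultimately show ?thesis by (simp add: has_symbol_def)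
qed

lemma evaluation_separating:
  assumes "\<And>w k. w \<in> \<Omega> \<Longrightarrow> k \<in> E_star M w \<Longrightarrow> evaluation k x = evaluation k y"
  shows "x = y"
proof -
  have "x $ j = y $ j" for j
    using assms by (intro B1_star_separating) (simp add: evaluation_def vec_eq_iff)
  then show ?thesis by (simp add: vec_eq_iff)
qed

text \<open>Symbols determine operators because the eigenvectors span a dense subspace, and operators
  determine symbols on \<open>\<Omega>\<close> because no eigenspace is zero.\<close>

lemma has_symbol_eq_iff:
  assumes F: "has_symbol \<Omega> M \<Phi> F" and G: "has_symbol \<Omega> M \<Gamma> G"
  shows "(\<forall>x. F x = G x) \<longleftrightarrow> (\<forall>w\<in>\<Omega>. \<Phi> w = \<Gamma> w)"
proof
  assume eq: "\<forall>w\<in>\<Omega>. \<Phi> w = \<Gamma> w"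
  show "\<forall>x. F x = G x"
    using F G eq by (intro allI evaluation_separating) (simp add: has_symbol_def)
next
  assume eq: "\<forall>x. F x = G x"
  show "\<forall>w\<in>\<Omega>. \<Phi> w = \<Gamma> w"
  proof
    fix w assume w: "w \<in> \<Omega>"
    then obtain k where k: "k \<noteq> 0" "E_star M w = range (\<lambda>c. c *\<^sub>C k)"
      by (rule B1_star_generator)
    then have kE: "k \<in> E_star M w" by (metis complex_space.scale_one rangeI)
    have "\<Phi> w *v v = \<Gamma> w *v v" for v
    proof -
      obtain x where x: "evaluation k x = v" using evaluation_surj[OF k(1)] .
      have "\<Phi> w *v evaluation k x = evaluation k (F x)" using F w kE by (simp add: has_symbol_def)
      also have "\<dots> = \<Gamma> w *v evaluation k x" using G w kE eq by (simp add: has_symbol_def)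
      finally show ?thesis by (simp add: x)
    qed
    then show "\<Phi> w = \<Gamma> w" by (simp add: matrix_eq)
  qed
qed

lemma evaluation_tensor_action:
  assumes "k \<in> E_star M w"
  shows "evaluation k (tensor_action M i x) = w $ i *s evaluation k x"
  using assms
  by (simp add: mem_E_star_iff[OF B1_star_bounded] evaluation_def tensor_action_def vec_eq_iff)

lemma has_symbol_intertwines:
  assumes F: "has_symbol \<Omega> M \<Phi> F"
  shows "F (tensor_action M i x) = tensor_action M i (F x)"
  by (rule evaluation_separating)
    (use F in \<open>simp add: has_symbol_def evaluation_tensor_action vector_scalar_commute\<close>)

text \<open>The adjoint of a module endomorphism maps each joint eigenspace into itself. As that eigenspace
  is a line, the adjoint acts on it as a scalar; the conjugates of these scalars are the values of
  the multiplier.\<close>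

lemma intertwiner_is_mult_op:
  assumes X: "bounded_clinear X" and int: "\<And>i x. X (M i x) = M i (X x)"
  shows "\<exists>\<phi>. is_mult_op \<Omega> M \<phi> X"
proof -
  have "\<exists>c. \<forall>k\<in>E_star M w. \<forall>x. cinner (X x) k = c * cinner x k" if w: "w \<in> \<Omega>" for w
  proof -
    obtain k where "k \<noteq> 0" and k: "E_star M w = range (\<lambda>c. c *\<^sub>C k)"
      using w by (rule B1_star_generator)
    then have kE: "k \<in> E_star M w" by (metis complex_space.scale_one rangeI)
    have "cinner (M i x) (cadjoint X k) = w $ i * cinner x (cadjoint X k)" for i x
      using kE by (simp add: mem_E_star_iff[OF B1_star_bounded] int flip: cinner_cadjoint[OF X])
    then have "cadjoint X k \<in> E_star M w" by (simp add: mem_E_star_iff[OF B1_star_bounded])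
    then obtain c where "cadjoint X k = c *\<^sub>C k" using k by auto
    then have "cinner (X x) k = cnj c * cinner x k" for x
      by (simp add: cinner_cadjoint[OF X] cinner_scaleC_right)
    then have "\<forall>k'\<in>E_star M w. \<forall>x. cinner (X x) k' = cnj c * cinner x k'"
      by (auto simp: k cinner_scaleC_right)
    then show ?thesis by blast
  qed
  then obtain \<phi> where "\<And>w k x. w \<in> \<Omega> \<Longrightarrow> k \<in> E_star M w \<Longrightarrow> cinner (X x) k = \<phi> w * cinner x k"
    by metis
  then have "is_mult_op \<Omega> M \<phi> X" using X by (simp add: is_mult_op_iff)
  then show ?thesis by blast
qed

lemma intertwiner_has_symbol:
  fixes F :: "'h ^ 'p::finite \<Rightarrow> 'h ^ 'q::finite"
  assumes F: "bounded_clinear F" and int: "\<And>i x. F (tensor_action M i x) = tensor_action M i (F x)"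
  obtains \<Phi> where "\<Phi> \<in> matrix_multipliers \<Omega> M" "has_symbol \<Omega> M \<Phi> F"
proof -
  define X where "X i j x = F (axis j x) $ i" for i j x
  have bX: "bounded_clinear (X i j)" for i j
    unfolding X_def[abs_def]
    by (intro bounded_clinear_compose[OF bounded_clinear_vec_nth]
        bounded_clinear_compose[OF F bounded_clinear_axis])
  have "tensor_action M l (axis j x) = axis j (M l x)" for l x and j :: 'p
    by (simp add: tensor_action_def axis_def vec_eq_iff bounded_clinear_0[OF B1_star_bounded])
  then have "X i j (M l x) = M l (X i j x)" for i j l x
    using int[of l "axis j x"] by (simp add: X_def tensor_action_def)
  then have "\<exists>\<phi>. is_mult_op \<Omega> M \<phi> (X i j)" for i j
    by (intro intertwiner_is_mult_op bX)
  then obtain \<phi> where \<phi>: "\<And>i j. is_mult_op \<Omega> M (\<phi> i j) (X i j)" by metis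
  define \<Phi> where "\<Phi> w = (\<chi> i j. \<phi> i j w)" for w
  have FX: "F x $ i = (\<Sum>j\<in>UNIV. X i j (x $ j))" for x i
  proof -
    have "F x = F (\<Sum>j\<in>UNIV. axis j (x $ j))" by (simp add: sum_axis_components)
    then show ?thesis by (simp add: bounded_clinear_sum_arg[OF F] X_def)
  qed
  show ?thesis
  proof
    show "\<Phi> \<in> matrix_multipliers \<Omega> M"
      using \<phi> by (auto simp: matrix_multipliers_def multipliers_def \<Phi>_def)
    show "has_symbol \<Omega> M \<Phi> F"
      using F \<phi>
      by (simp add: has_symbol_def is_mult_op_iff evaluation_def vec_eq_iff FX cinner_sum_left
          matrix_vector_mult_def \<Phi>_def)
  qed
qed

text \<open>The operator \<open>M\<^sub>\<Theta> M\<^sub>\<Psi>\<close> is an idempotent module map with the same range as \<open>M\<^sub>\<Theta>\<close>. By the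
  description of similarity for the quotient by such a range, similarity amounts to the existence
  of two module maps between the tensor products; these have symbols, and the operator identities
  they satisfy are identities between their symbols. In the resulting criterion \<open>M\<close> only enters
  through its multipliers.\<close>

lemma similar_quotient_by_iff:
  fixes \<Theta> :: "complex ^ 'n \<Rightarrow> complex ^ 'p::finite ^ 'q::finite"
  assumes \<Theta>: "\<Theta> \<in> matrix_multipliers \<Omega> M" and \<Psi>: "\<Psi> \<in> matrix_multipliers \<Omega> M"
    and left_inverse: "\<forall>w\<in>\<Omega>. \<Psi> w ** \<Theta> w = mat 1"
  shows "similar_modules (quotient_by \<Omega> M \<Theta>)
      (full_module (tensor_action M :: 'n \<Rightarrow> 'h ^ 'r::finite \<Rightarrow> 'h ^ 'r)) \<longleftrightarrow>
    (\<exists>\<Phi>\<in>matrix_multipliers \<Omega> M. \<exists>\<Gamma>\<in>matrix_multipliers \<Omega> M. \<forall>w\<in>\<Omega>.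
       \<Phi> w ** \<Gamma> w = (mat 1 :: complex ^ 'r ^ 'r) \<and> \<Gamma> w ** \<Phi> w = mat 1 - \<Theta> w ** \<Psi> w)"
    (is "?similar \<longleftrightarrow> ?symbols")
proof -
  let ?T = "matrix_mult_op \<Omega> M \<Theta>" and ?S = "matrix_mult_op \<Omega> M \<Psi>"
  define P where "P x = ?T (?S x)" for x
  note sT = has_symbol_matrix_mult_op[OF \<Theta>] and sS = has_symbol_matrix_mult_op[OF \<Psi>]
  have sP: "has_symbol \<Omega> M (\<lambda>w. \<Theta> w ** \<Psi> w) P"
    using has_symbol_compose[OF sT sS] by (simp add: P_def[abs_def])
  have sQ: "has_symbol \<Omega> M (\<lambda>w. mat 1 - \<Theta> w ** \<Psi> w) (\<lambda>x. x - P x)"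
    by (rule has_symbol_diff[OF has_symbol_id sP])
  have "\<forall>x. ?S (?T x) = x"
    using has_symbol_eq_iff[OF has_symbol_compose[OF sS sT] has_symbol_id] left_inverse by simp
  then have ST: "\<And>x. ?S (?T x) = x" by simp
  have ran: "range ?T = range P"
  proof
    show "range ?T \<subseteq> range P"
    proof
      fix y assume "y \<in> range ?T"
      then obtain x where "y = ?T x" by blast
      then have "y = P (?T x)" by (simp add: P_def ST)
      then show "y \<in> range P" by blast
    qed
  qed (auto simp: P_def)
  have bL: "bounded_clinear (tensor_action M i :: 'h ^ 'q \<Rightarrow> _)" for i
    by (rule bounded_clinear_tensor_action[OF B1_star_bounded])
  have bP: "bounded_clinear P" using sP by (simp add: has_symbol_def)
  have idem: "\<And>x. P (P x) = P x" by (simp add: P_def ST)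
  note criterion = similar_quotient_idempotent_iff[OF bL bP idem has_symbol_intertwines[OF sP],
      where L' = "tensor_action M :: 'n \<Rightarrow> 'h ^ 'r \<Rightarrow> 'h ^ 'r"]
  show ?thesis unfolding quotient_by_def ran criterion
  proof
    assume "\<exists>A B. bounded_clinear A \<and> bounded_clinear B \<and>
       (\<forall>i x. A (tensor_action M i x) = (tensor_action M i (A x) :: 'h ^ 'r)) \<and>
       (\<forall>i y. B (tensor_action M i y) = tensor_action M i (B y)) \<and>
       (\<forall>y. A (B y) = y) \<and> (\<forall>x. B (A x) = x - P x)"
    then obtain A :: "'h ^ 'q \<Rightarrow> 'h ^ 'r" and B
      where A: "bounded_clinear A" "\<And>i x. A (tensor_action M i x) = tensor_action M i (A x)"
        and B: "bounded_clinear B" "\<And>i y. B (tensor_action M i y) = tensor_action M i (B y)"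
        and AB: "\<forall>y. A (B y) = y" and BA: "\<forall>x. B (A x) = x - P x" by blast
    obtain \<Phi> where \<Phi>: "\<Phi> \<in> matrix_multipliers \<Omega> M" and sA: "has_symbol \<Omega> M \<Phi> A"
      using intertwiner_has_symbol[OF A] .
    obtain \<Gamma> where \<Gamma>: "\<Gamma> \<in> matrix_multipliers \<Omega> M" and sB: "has_symbol \<Omega> M \<Gamma> B"
      using intertwiner_has_symbol[OF B] .
    show ?symbols
      using \<Phi> \<Gamma> AB BA has_symbol_eq_iff[OF has_symbol_compose[OF sA sB] has_symbol_id]
        has_symbol_eq_iff[OF has_symbol_compose[OF sB sA] sQ] by blast
  next
    assume ?symbols
    then obtain \<Phi> :: "complex ^ 'n \<Rightarrow> complex ^ 'q ^ 'r" and \<Gamma>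
      where \<Phi>: "\<Phi> \<in> matrix_multipliers \<Omega> M" and \<Gamma>: "\<Gamma> \<in> matrix_multipliers \<Omega> M"
        and eqs: "\<forall>w\<in>\<Omega>. \<Phi> w ** \<Gamma> w = mat 1 \<and> \<Gamma> w ** \<Phi> w = mat 1 - \<Theta> w ** \<Psi> w" by blast
    note sA = has_symbol_matrix_mult_op[OF \<Phi>] and sB = has_symbol_matrix_mult_op[OF \<Gamma>]
    show "\<exists>A B. bounded_clinear A \<and> bounded_clinear B \<and>
       (\<forall>i x. A (tensor_action M i x) = (tensor_action M i (A x) :: 'h ^ 'r)) \<and>
       (\<forall>i y. B (tensor_action M i y) = tensor_action M i (B y)) \<and>
       (\<forall>y. A (B y) = y) \<and> (\<forall>x. B (A x) = x - P x)"
    proof (intro exI conjI)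
      show "bounded_clinear (matrix_mult_op \<Omega> M \<Phi>)" "bounded_clinear (matrix_mult_op \<Omega> M \<Gamma>)"
        using sA sB by (simp_all add: has_symbol_def)
      show "\<forall>y. matrix_mult_op \<Omega> M \<Phi> (matrix_mult_op \<Omega> M \<Gamma> y) = y"
        using has_symbol_eq_iff[OF has_symbol_compose[OF sA sB] has_symbol_id] eqs by blast
      show "\<forall>x. matrix_mult_op \<Omega> M \<Gamma> (matrix_mult_op \<Omega> M \<Phi> x) = x - P x"
        using has_symbol_eq_iff[OF has_symbol_compose[OF sB sA] sQ] eqs by blast
    qed (simp_all add: has_symbol_intertwines[OF sA] has_symbol_intertwines[OF sB])
  qed
qed

end


section \<open>Transfer of similarity\<close>

theorem theorem4p3:
  fixes \<Omega> :: "(complex ^ 'n::finite) set"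
    and M :: "'n \<Rightarrow> 'h::complex_hilbert \<Rightarrow> 'h"
    and M' :: "'n \<Rightarrow> 'k::complex_hilbert \<Rightarrow> 'k"
    and \<Theta> :: "complex ^ 'n \<Rightarrow> complex ^ 'p::finite ^ 'q::finite"
  assumes "open \<Omega>" and "connected \<Omega>"
    and "M \<in> B1_star \<Omega>" and "M' \<in> B1_star \<Omega>"
    and "multipliers \<Omega> M \<subseteq> multipliers \<Omega> M'"
    and "CARD('p) < CARD('q)" and "CARD('r::finite) = CARD('q) - CARD('p)"
    and "\<Theta> \<in> matrix_multipliers \<Omega> M"
    and "\<exists>\<Psi> \<in> matrix_multipliers \<Omega> M. \<forall>w\<in>\<Omega>. \<Psi> w ** \<Theta> w = mat 1"
    and "similar_modules (quotient_by \<Omega> M \<Theta>)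
           (full_module (tensor_action M :: 'n \<Rightarrow> 'h ^ 'r \<Rightarrow> 'h ^ 'r))"
  shows "similar_modules (quotient_by \<Omega> M' \<Theta>)
           (full_module (tensor_action M' :: 'n \<Rightarrow> 'k ^ 'r \<Rightarrow> 'k ^ 'r))"
proof -
  have sub: "\<Phi> \<in> matrix_multipliers \<Omega> M'" if "\<Phi> \<in> matrix_multipliers \<Omega> M"
    for \<Phi> :: "complex ^ 'n \<Rightarrow> complex ^ 'a::finite ^ 'b::finite"
    using that assms(5) by (auto simp: matrix_multipliers_def)
  obtain \<Psi> where \<Psi>: "\<Psi> \<in> matrix_multipliers \<Omega> M" "\<forall>w\<in>\<Omega>. \<Psi> w ** \<Theta> w = mat 1"
    using assms(9) by blast
  have "\<exists>\<Phi>\<in>matrix_multipliers \<Omega> M. \<exists>\<Gamma>\<in>matrix_multipliers \<Omega> M. \<forall>w\<in>\<Omega>.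
      \<Phi> w ** \<Gamma> w = (mat 1 :: complex ^ 'r ^ 'r) \<and> \<Gamma> w ** \<Phi> w = mat 1 - \<Theta> w ** \<Psi> w"
    using assms(10) unfolding similar_quotient_by_iff[OF assms(3,8) \<Psi>] .
  then have "\<exists>\<Phi>\<in>matrix_multipliers \<Omega> M'. \<exists>\<Gamma>\<in>matrix_multipliers \<Omega> M'. \<forall>w\<in>\<Omega>.
      \<Phi> w ** \<Gamma> w = (mat 1 :: complex ^ 'r ^ 'r) \<and> \<Gamma> w ** \<Phi> w = mat 1 - \<Theta> w ** \<Psi> w"
    by (elim bexE) (intro bexI sub)
  then show ?thesis
    unfolding similar_quotient_by_iff[OF assms(4) sub[OF assms(8)] sub[OF \<Psi>(1)] \<Psi>(2)] .
qed

end
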